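(* Suppose that for each $l=1,\dots,M+Q$ the induced subgraph $\mathcal{G}^{[l]}$ is undirected and connected, and that for each $i\in\mathcal{V}$: $f_i$ is $\nu$-strongly convex with $\nu>0$ and has $\alpha$-Lipschitz gradients for some $\alpha>0$, and the matrix whose rows are $A_i^{[m]}$, $m\in\mathcal{I}_i$, and $E_i^{[q]}$, $q\in\mathcal{E}_i$, has full row rank. Let $\alpha_\phi$ be a (finite) Lipschitz constant of $\nabla\phi$. If the parameter $\gamma_t$ in the violation-free distributed accelerated dual averaging algorithm described in the context is set as $\gamma_t=\gamma(t+1)$ where $\gamma\le 1/(2\alpha_\phi)$, then, for all $t\ge 2$, the solution $\big(x_i(\hat y_i^{(t)})\big)_{i=1}^N$ of the reformulated problem with auxiliary variable $y=\hat y^{(t)}$ is a feasible solution of $(\mathrm{P})$ and satisfies $$\sum_{i=1}^N \Big(f_i\big(x_i(\hat y_i^{(t)})\big)-f_i(x_i^* )\Big)\le\frac{\|y^{(0)}-y^*\|^2}{2\Gamma_t}=\frac{2\alpha_\phi\|y^{(0)}-y^*\|^2}{t(t+3)},$$ where $y^{(0)}$ denotes the initial variable, $y^*$ is any (fixed) minimizer of $\min_y\phi(y)$, and $(x_i^* )_{i=1}^N$ is an optimal solution of $(\mathrm{P})$.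
   Context: Agents are indexed by $\mathcal{V}=\{1,\dots,N\}$. For each agent $i$: $x_i\in\mathbb{R}^{d_i}$, $f_i:\mathbb{R}^{d_i}\to\mathbb{R}$, $A_i\in\mathbb{R}^{M\times d_i}$, $b_i\in\mathbb{R}^M$, $E_i\in\mathbb{R}^{Q\times d_i}$, $g_i\in\mathbb{R}^Q$. $A_i^{[m]}$ is the $m$-th row of $A_i$ and $b_i^{[m]}$ the $m$-th entry of $b_i$; $E_i^{[q]}$, $g_i^{[q]}$ similarly. $f$ is $\nu$-strongly convex if $f(y)-f(x)\ge\langle\nabla f(x),y-x\rangle+\frac{\nu}{2}\|y-x\|^2$ for all $x,y$, and has $\alpha$-Lipschitz gradients if $\|\nabla f(y)-\nabla f(x)\|\le\alpha\|y-x\|$ for all $x,y$. The original problem is $$(\mathrm{P})\quad \min_{x_1,\dots,x_N}\ \sum_{i=1}^N f_i(x_i)\quad\text{s.t.}\quad \sum_{i=1}^N (A_i x_i+b_i)\le 0,\qquad \sum_{i=1}^N (E_i x_i+g_i)=0.$$ Affected agents: $\mathcal{V}^{[m]}=\{j: A_j^{[m]}\ne 0 \text{ or } b_j^{[m]}\neq 0\}$ for $m=1,\dots,M$, and $\mathcal{V}^{[M+q]}=\{j: E_j^{[q]}\ne0\text{ or }g_j^{[q]}\ne0\}$ for $q=1,\dots,Q$. $\mathcal{I}_i=\{m: i\in\mathcal{V}^{[m]}\}$ and $\mathcal{E}_i=\{q: i\in\mathcal{V}^{[M+q]}\}$ are the sets of inequality and equality constraints affecting agent $i$; write $\mathcal{L}_i=\mathcal{I}_i\cup\{M+q:q\in\mathcal{E}_i\}$.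 Communication: $\mathcal{G}=(\mathcal{V},\mathcal{S})$ is an undirected graph; $\mathcal{G}^{[l]}$ is the subgraph of $\mathcal{G}$ induced by $\mathcal{V}^{[l]}$, $l=1,\dots,M+Q$; $\mathcal{N}_i^{[l]}$ is the set of neighbors of $i$ in $\mathcal{G}^{[l]}$, including $i$ itself. For each $l$, $P^{[l]}=[p_{ij}^{[l]}]$ is a symmetric nonnegative matrix with rows and columns indexed by $\mathcal{V}^{[l]}$, with $p_{ij}^{[l]}>0$ if $j\in\mathcal{N}_i^{[l]}$, $p_{ij}^{[l]}=0$ otherwise, and $\sum_j p_{ij}^{[l]}=1$ for all $i$. Auxiliary variables: $y^{[l]}=\mathrm{col}(\{y_i^{[l]}\}_{i\in\mathcal{V}^{[l]}})\in\mathbb{R}^{|\mathcal{V}^{[l]}|}$ ($\mathrm{col}$ denotes stacking), $y=\mathrm{col}(y^{[1]},\dots,y^{[M+Q]})$, and $y_i$ is the collection of those $y_j^{[l]}$ with $j\in\mathcal{N}_i^{[l]}$, $l\in\mathcal{L}_i$. Local problem: for given $y_i$, $$(\mathrm{P}_i)\quad \phi_i(y_i)=\min_{x_i} f_i(x_i)\ \text{ s.t. }\ A_i^{[m]}x_i+y_i^{[m]}-\sum_{j}p_{ij}^{[m]}y_j^{[m]}+b_i^{[m]}\le0,\ m\in\mathcal{I}_i,$$ $$E_i^{[q]}x_i+y_i^{[M+q]}-\sum_j p_{ij}^{[M+q]}y_j^{[M+q]}+g_i^{[q]}=0,\ q\in\mathcal{E}_i,$$ with optimal solution $x_i(y_i)$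 and KKT multipliers $\mu_i^{[m]}(y_i)$, $m\in\mathcal{I}_i$ (inequalities), and $\lambda_i^{[q]}(y_i)$, $q\in\mathcal{E}_i$ (equalities). Put $\phi(y)=\sum_{i=1}^N\phi_i(y_i)$. The reformulated problem is to minimize $\sum_i f_i(x_i)$ jointly over $(x,y)$ subject to all constraints of $(\mathrm{P}_1),\dots,(\mathrm{P}_N)$; for fixed $y$ its solution is $(x_i(y_i))_{i=1}^N$, so it is equivalent to $\min_y\phi(y)$. Under the hypotheses $\phi$ is convex and differentiable with Lipschitz continuous gradient, and $$\nabla_{y^{[m]}}\phi(y)=(I-P^{[m]})^T\mathrm{col}(\{\mu_i^{[m]}(y_i)\}_{i\in\mathcal{V}^{[m]}}),\qquad \nabla_{y^{[M+q]}}\phi(y)=(I-P^{[M+q]})^T\mathrm{col}(\{\lambda_i^{[q]}(y_i)\}_{i\in\mathcal{V}^{[M+q]}}).$$ Algorithm (violation-free distributed accelerated dual averaging): the input is an arbitrary variable $y$ and parameters $\{\gamma_t\}_{t\ge0}$, $\Gamma_t=\sum_{\tau=1}^t\gamma_\tau$. For $t=1,2,\dots$, each agent $i$ collects $y_j^{[l]}$ from each $j\in\mathcal{N}_i^{[l]}$, $l\in\mathcal{L}_i$; solves $(\mathrm{P}_i)$ to obtain $x_i(y_i)$ and its multipliers; collects the corresponding multipliers from its neighbors; and computes $\nabla_{y_i^{[l]}}\phi(y)$, $l\in\mathcal{L}_i$, from the formulas above. If $t=1$, it sets $\hat y_i^{[l]}=z_i^{[l]}=-\gamma_1\nabla_{y_i^{[l]}}\phi(y)$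 for all $l\in\mathcal{L}_i$. Otherwise it updates, for all $l\in\mathcal{L}_i$, $$y_i^{[l]}\leftarrow\Big(1-\tfrac{\gamma_t}{\Gamma_t}\Big)\hat y_i^{[l]}+\tfrac{\gamma_t}{\Gamma_t}z_i^{[l]},\qquad z_i^{[l]}\leftarrow z_i^{[l]}-\gamma_t\nabla_{y_i^{[l]}}\phi(y),\qquad \hat y_i^{[l]}\leftarrow\Big(1-\tfrac{\gamma_t}{\Gamma_t}\Big)\hat y_i^{[l]}+\tfrac{\gamma_t}{\Gamma_t}z_i^{[l]}.$$ The output is $x_i(\hat y_i)$, $i=1,\dots,N$. Here $\hat y^{(t)}$ denotes the value of $\hat y$ at iteration $t$, and $\hat y_i^{(t)}$ the collection of components of $\hat y^{(t)}$ relevant to agent $i$, as for $y_i$.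
   Formalization: The bound is claimed only when z starts at y^(0) (z = y^(0) − γ_1∇φ(y^(0)) at t=1), and the equality only for γ = 1/(2α_φ), as both fail otherwise; γ>0 and α_φ>0 are assumed, and for t≥2 the gradient in the z-update is taken at the just-updated y. *)

theory Defs
  imports "HOL-Analysis.Analysis"
begin

text \<open>
  The dimensions \<open>d\<^sub>i\<close> differ from agent to agent, so the space of agent \<open>i\<close> is rendered as
  the coordinate subspace of \<open>real^'d\<close> spanned by a set of \<open>d\<^sub>i\<close> coordinates; with \<open>'d\<close> large
  enough every family \<open>(d\<^sub>i)\<close> arises in this way.
  Agents are indexed by \<open>'v\<close>, inequality constraints by \<open>'m\<close>, equality constraints by \<open>'q\<close>, and
  the joint index \<open>l = 1, \<dots>, M + Q\<close> is \<open>'m + 'q\<close>.  A problem without inequality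
  (or equality) constraints is the case of a single one whose data are all zero: it affects no
  agent and has no auxiliary variables.
\<close>

definition coord_space :: "'d::finite set \<Rightarrow> (real^'d) set" where
  "coord_space D = {x. \<forall>k. k \<notin> D \<longrightarrow> x $ k = 0}"

text \<open>
  Functions on a subspace \<open>S\<close> are functions on the ambient space of which only the values on \<open>S\<close>
  matter.  The gradient is the unique element of \<open>S\<close> that represents the derivative within \<open>S\<close>.
\<close>

definition has_grad_on :: "'a::real_inner set \<Rightarrow> ('a \<Rightarrow> real) \<Rightarrow> 'a \<Rightarrow> 'a \<Rightarrow> bool" where
  "has_grad_on S f x v \<longleftrightarrow> v \<in> S \<and> (f has_derivative (\<lambda>h. v \<bullet> h)) (at x within S)"

definition grad_on :: "'a::real_inner set \<Rightarrow> ('a \<Rightarrow> real) \<Rightarrow> 'a \<Rightarrow> 'a" where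
  "grad_on S f x = (THE v. has_grad_on S f x v)"

definition strongly_convex_on :: "'a::real_inner set \<Rightarrow> real \<Rightarrow> ('a \<Rightarrow> real) \<Rightarrow> bool" where
  "strongly_convex_on S \<nu> f \<longleftrightarrow>
     (\<forall>x\<in>S. \<forall>y\<in>S. f y - f x \<ge> grad_on S f x \<bullet> (y - x) + \<nu> / 2 * (norm (y - x))\<^sup>2)"

record ('v, 'd::finite, 'm::finite, 'q::finite) problem =
  coords   :: "'v \<Rightarrow> 'd set"
  cost     :: "'v \<Rightarrow> real^'d \<Rightarrow> real"
  ineq_mat :: "'v \<Rightarrow> real^'d^'m"
  ineq_vec :: "'v \<Rightarrow> real^'m"
  eq_mat   :: "'v \<Rightarrow> real^'d^'q"
  eq_vec   :: "'v \<Rightarrow> real^'q"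
  edges    :: "('v \<times> 'v) set"
  weight   :: "'m + 'q \<Rightarrow> 'v \<Rightarrow> 'v \<Rightarrow> real"

abbreviation agent_space ::
    "('v::finite, 'd::finite, 'm::finite, 'q::finite) problem \<Rightarrow> 'v \<Rightarrow> (real^'d) set" where
  "agent_space Pr i \<equiv> coord_space (coords Pr i)"

definition con_row ::
    "('v::finite, 'd::finite, 'm::finite, 'q::finite) problem \<Rightarrow> 'v \<Rightarrow> 'm + 'q \<Rightarrow> real^'d" where
  "con_row Pr i l = (case l of Inl m \<Rightarrow> ineq_mat Pr i $ m | Inr q \<Rightarrow> eq_mat Pr i $ q)"

definition con_const ::
    "('v::finite, 'd::finite, 'm::finite, 'q::finite) problem \<Rightarrow> 'v \<Rightarrow> 'm + 'q \<Rightarrow> real" where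
  "con_const Pr i l = (case l of Inl m \<Rightarrow> ineq_vec Pr i $ m | Inr q \<Rightarrow> eq_vec Pr i $ q)"

definition P_feasible ::
    "('v::finite, 'd::finite, 'm::finite, 'q::finite) problem \<Rightarrow> ('v \<Rightarrow> real^'d) set" where
  "P_feasible Pr = {x. (\<forall>i. x i \<in> agent_space Pr i) \<and>
     (\<Sum>i\<in>UNIV. ineq_mat Pr i *v x i + ineq_vec Pr i) \<le> 0 \<and>
     (\<Sum>i\<in>UNIV. eq_mat Pr i *v x i + eq_vec Pr i) = 0}"

definition P_optimal ::
    "('v::finite, 'd::finite, 'm::finite, 'q::finite) problem \<Rightarrow> ('v \<Rightarrow> real^'d) \<Rightarrow> bool" where
  "P_optimal Pr x \<longleftrightarrow> is_arg_min (\<lambda>x. \<Sum>i\<in>UNIV. cost Pr i (x i)) (\<lambda>x. x \<in> P_feasible Pr) x"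

definition affected ::
    "('v::finite, 'd::finite, 'm::finite, 'q::finite) problem \<Rightarrow> 'm + 'q \<Rightarrow> 'v set" where
  "affected Pr l = {j. con_row Pr j l \<noteq> 0 \<or> con_const Pr j l \<noteq> 0}"

definition agent_cons ::
    "('v::finite, 'd::finite, 'm::finite, 'q::finite) problem \<Rightarrow> 'v \<Rightarrow> ('m + 'q) set" where
  "agent_cons Pr i = {l. i \<in> affected Pr l}"

text \<open>The rank is the dimension of the span of the rows, cf. \<open>row_rank_def\<close>.\<close>

definition full_row_rank ::
    "('v::finite, 'd::finite, 'm::finite, 'q::finite) problem \<Rightarrow> 'v \<Rightarrow> bool" where
  "full_row_rank Pr i \<longleftrightarrow> dim (con_row Pr i ` agent_cons Pr i) = card (agent_cons Pr i)"

definition induced_edges ::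
    "('v::finite, 'd::finite, 'm::finite, 'q::finite) problem \<Rightarrow> 'm + 'q \<Rightarrow> ('v \<times> 'v) set" where
  "induced_edges Pr l = edges Pr \<inter> (affected Pr l \<times> affected Pr l)"

definition induced_connected ::
    "('v::finite, 'd::finite, 'm::finite, 'q::finite) problem \<Rightarrow> 'm + 'q \<Rightarrow> bool" where
  "induced_connected Pr l \<longleftrightarrow>
     (\<forall>i\<in>affected Pr l. \<forall>j\<in>affected Pr l. (i, j) \<in> (induced_edges Pr l)\<^sup>*)"

definition nbrs ::
    "('v::finite, 'd::finite, 'm::finite, 'q::finite) problem \<Rightarrow> 'm + 'q \<Rightarrow> 'v \<Rightarrow> 'v set" where
  "nbrs Pr l i = insert i {j. (i, j) \<in> induced_edges Pr l}"

text \<open>The entries of \<open>weight Pr l\<close> outside \<open>affected Pr l\<close> are never used.\<close>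

definition weights_ok ::
    "('v::finite, 'd::finite, 'm::finite, 'q::finite) problem \<Rightarrow> 'm + 'q \<Rightarrow> bool" where
  "weights_ok Pr l \<longleftrightarrow>
     (\<forall>i\<in>affected Pr l. \<forall>j\<in>affected Pr l.
        weight Pr l i j = weight Pr l j i \<and>
        (if j \<in> nbrs Pr l i then weight Pr l i j > 0 else weight Pr l i j = 0)) \<and>
     (\<forall>i\<in>affected Pr l. (\<Sum>j\<in>affected Pr l. weight Pr l i j) = 1)"

definition aux_space ::
    "('v::finite, 'd::finite, 'm::finite, 'q::finite) problem \<Rightarrow> (real^'v^('m + 'q)) set" where
  "aux_space Pr = {y. \<forall>l i. i \<notin> affected Pr l \<longrightarrow> y $ l $ i = 0}"

text \<open>
  Left-hand sides of the local constraints.  The whole of \<open>y\<close> is passed on; as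
  \<open>weight Pr l i j = 0\<close> unless \<open>j \<in> nbrs Pr l i\<close>, only the part \<open>y\<^sub>i\<close> enters.
\<close>

definition local_lhs ::
    "('v::finite, 'd::finite, 'm::finite, 'q::finite) problem \<Rightarrow> 'v \<Rightarrow> real^'v^('m + 'q) \<Rightarrow>
     real^'d \<Rightarrow> 'm + 'q \<Rightarrow> real" where
  "local_lhs Pr i y x l =
     con_row Pr i l \<bullet> x + y $ l $ i - (\<Sum>j\<in>affected Pr l. weight Pr l i j * y $ l $ j)
       + con_const Pr i l"

definition local_feasible ::
    "('v::finite, 'd::finite, 'm::finite, 'q::finite) problem \<Rightarrow> 'v \<Rightarrow> real^'v^('m + 'q) \<Rightarrow>
     (real^'d) set" where
  "local_feasible Pr i y = {x \<in> agent_space Pr i.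
     (\<forall>m. Inl m \<in> agent_cons Pr i \<longrightarrow> local_lhs Pr i y x (Inl m) \<le> 0) \<and>
     (\<forall>q. Inr q \<in> agent_cons Pr i \<longrightarrow> local_lhs Pr i y x (Inr q) = 0)}"

definition local_sol ::
    "('v::finite, 'd::finite, 'm::finite, 'q::finite) problem \<Rightarrow> 'v \<Rightarrow> real^'v^('m + 'q) \<Rightarrow>
     real^'d" where
  "local_sol Pr i y = arg_min (cost Pr i) (\<lambda>x. x \<in> local_feasible Pr i y)"

definition phi_local ::
    "('v::finite, 'd::finite, 'm::finite, 'q::finite) problem \<Rightarrow> 'v \<Rightarrow> real^'v^('m + 'q) \<Rightarrow>
     real" where
  "phi_local Pr i y = cost Pr i (local_sol Pr i y)"

definition phi ::
    "('v::finite, 'd::finite, 'm::finite, 'q::finite) problem \<Rightarrow> real^'v^('m + 'q) \<Rightarrow> real" where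
  "phi Pr y = (\<Sum>i\<in>UNIV. phi_local Pr i y)"

text \<open>Multipliers for both kinds of constraints: \<open>u (Inl m)\<close> is \<open>\<mu>\<^sub>i\<close>, \<open>u (Inr q)\<close> is \<open>\<lambda>\<^sub>i\<close>.\<close>

definition is_kkt_mult ::
    "('v::finite, 'd::finite, 'm::finite, 'q::finite) problem \<Rightarrow> 'v \<Rightarrow> real^'v^('m + 'q) \<Rightarrow>
     real^'d \<Rightarrow> ('m + 'q \<Rightarrow> real) \<Rightarrow> bool" where
  "is_kkt_mult Pr i y x u \<longleftrightarrow>
     x \<in> local_feasible Pr i y \<and>
     grad_on (agent_space Pr i) (cost Pr i) x
       + (\<Sum>l\<in>agent_cons Pr i. u l *\<^sub>R con_row Pr i l) = 0 \<and>
     (\<forall>m. Inl m \<in> agent_cons Pr i \<longrightarrow>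
        u (Inl m) \<ge> 0 \<and> u (Inl m) * local_lhs Pr i y x (Inl m) = 0)"

definition kkt_mult ::
    "('v::finite, 'd::finite, 'm::finite, 'q::finite) problem \<Rightarrow> 'v \<Rightarrow> real^'v^('m + 'q) \<Rightarrow>
     'm + 'q \<Rightarrow> real" where
  "kkt_mult Pr i y = (SOME u. is_kkt_mult Pr i y (local_sol Pr i y) u)"

text \<open>
  The expression \<open>(I - P)\<^sup>T col(\<dots>)\<close> of the multipliers by which the agents compute the gradient
  of \<^term>\<open>phi\<close>; that it equals \<open>grad_on (aux_space Pr) (phi Pr)\<close> is not part of the definition.
\<close>

definition mult_grad ::
    "('v::finite, 'd::finite, 'm::finite, 'q::finite) problem \<Rightarrow> real^'v^('m + 'q) \<Rightarrow>
     real^'v^('m + 'q)" where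
  "mult_grad Pr y = (\<chi> l j. if j \<in> affected Pr l
     then \<Sum>i\<in>affected Pr l. (of_bool (i = j) - weight Pr l i j) * kkt_mult Pr i y l
     else 0)"

definition Gam :: "(nat \<Rightarrow> real) \<Rightarrow> nat \<Rightarrow> real" where
  "Gam \<gamma> t = (\<Sum>\<tau>=1..t. \<gamma> \<tau>)"

text \<open>
  The variables \<open>(y, z, yhat)\<close> after iteration \<open>t\<close>.  Each gradient is taken at the current \<open>y\<close>:
  at the input \<open>y0\<close> for \<open>t = 1\<close>, at the just updated \<open>y\<close> for \<open>t \<ge> 2\<close>.  The parameter \<open>z0\<close> is
  the value of \<open>z\<close> before the first gradient step; \<open>z0 = 0\<close> is the initialisation
  \<open>yhat = z = - \<gamma> 1 * mult_grad Pr y0\<close>.  The bound on the objective needs \<open>z0 = y0\<close>,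
  the point to which the distance of the minimiser is measured.
\<close>

fun dual_avg ::
    "('v::finite, 'd::finite, 'm::finite, 'q::finite) problem \<Rightarrow> (nat \<Rightarrow> real) \<Rightarrow>
     real^'v^('m + 'q) \<Rightarrow> real^'v^('m + 'q) \<Rightarrow> nat \<Rightarrow>
     (real^'v^('m + 'q)) \<times> (real^'v^('m + 'q)) \<times> (real^'v^('m + 'q))" where
  "dual_avg Pr \<gamma> z0 y0 0 = (y0, z0, y0)"
| "dual_avg Pr \<gamma> z0 y0 (Suc 0) =
     (let z = z0 - \<gamma> 1 *\<^sub>R mult_grad Pr y0 in (y0, z, z))"
| "dual_avg Pr \<gamma> z0 y0 (Suc (Suc n)) =
     (let t = Suc (Suc n);
          r = \<gamma> t / Gam \<gamma> t;
          (_, z, yhat) = dual_avg Pr \<gamma> z0 y0 (Suc n);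
          y' = (1 - r) *\<^sub>R yhat + r *\<^sub>R z;
          z' = z - \<gamma> t *\<^sub>R mult_grad Pr y';
          yhat' = (1 - r) *\<^sub>R yhat + r *\<^sub>R z'
      in (y', z', yhat'))"

definition yhat ::
    "('v::finite, 'd::finite, 'm::finite, 'q::finite) problem \<Rightarrow> (nat \<Rightarrow> real) \<Rightarrow>
     real^'v^('m + 'q) \<Rightarrow> real^'v^('m + 'q) \<Rightarrow> nat \<Rightarrow> real^'v^('m + 'q)" where
  "yhat Pr \<gamma> z0 y0 t = snd (snd (dual_avg Pr \<gamma> z0 y0 t))"

end

theory Submission
  imports Defs
begin

text \<open>
  The column sums of \<open>P\<^sup>[\<^sup>l\<^sup>]\<close> are one, so the auxiliary terms cancel in the sum of the local constraints:
  the local solutions are feasible for (P) whatever \<open>y\<close> is.  The value function \<open>\<phi>\<close> is convex and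
  differentiable by an envelope argument: weak duality gives the affine lower bound with slope
  \<open>(I - P)\<^sup>T \<mu>\<close>, and by full row rank the local solution can be shifted linearly in \<open>y\<close> so as to stay
  feasible, which gives an upper bound with the same slope.  Accelerated dual averaging then makes
  \<open>\<Gamma>\<^sub>t (\<phi> yhat\<^sub>t - \<phi> y\<^sup>*) + \<parallel>y\<^sup>* - z\<^sub>t\<parallel>\<^sup>2 / 2\<close> nonincreasing.  Finally, by connectedness \<open>I - P\<^sup>[\<^sup>l\<^sup>]\<close>
  maps onto the vectors of sum zero, so some \<open>y\<close> distributes the slack of a solution of (P) evenly over
  the affected agents; hence \<open>\<phi> y\<^sup>*\<close> is at most the optimal value of (P).
\<close>

section \<open>Gradients within a subspace\<close>

text \<open>A line through \<open>x\<close> in a direction of \<open>S\<close> stays in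
  \<open>S\<close>, so the chain rule applies within \<open>S\<close>. This reduces later arguments
  to calculus in one variable.\<close>

lemma has_grad_on_line:
  fixes S :: "'a::real_inner set"
  assumes "subspace S" "x \<in> S" "h \<in> S" and v: "has_grad_on S f (x + t *\<^sub>R h) v"
  shows "((\<lambda>t. f (x + t *\<^sub>R h)) has_real_derivative v \<bullet> h) (at t)"
proof -
  have sub: "range (\<lambda>t. x + t *\<^sub>R h) \<subseteq> S"
    using assms by (auto intro: subspace_add subspace_scale)
  have "((\<lambda>t. x + t *\<^sub>R h) has_derivative (\<lambda>t. t *\<^sub>R h)) (at t)"
    by (auto intro!: derivative_eq_intros)
  moreover have "(f has_derivative (\<lambda>h. v \<bullet> h)) (at (x + t *\<^sub>R h) within range (\<lambda>t. x + t *\<^sub>R h))"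
    using v sub unfolding has_grad_on_def by (blast intro: has_derivative_subset)
  ultimately have "((\<lambda>t. f (x + t *\<^sub>R h)) has_derivative (\<lambda>t. v \<bullet> (t *\<^sub>R h))) (at t)"
    by (rule has_derivative_in_compose)
  then show ?thesis
    unfolding has_field_derivative_def by (simp add: mult_commute_abs)
qed

text \<open>Both vectors lie in \<open>S\<close>, so their difference is an admissible direction to
  test with. This justifies the definite description in \<open>grad_on\<close>.\<close>

lemma has_grad_on_unique:
  fixes S :: "'a::real_inner set"
  assumes "subspace S" "x \<in> S" and v: "has_grad_on S f x v" and w: "has_grad_on S f x w"
  shows "v = w"
proof -
  have h: "v - w \<in> S"
    using assms by (auto simp: has_grad_on_def intro: subspace_diff)
  have "v \<bullet> (v - w) = w \<bullet> (v - w)"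
    using has_grad_on_line[OF assms(1,2) h, where t = 0 and f = f] v w
    by (intro DERIV_unique) auto
  then have "(v - w) \<bullet> (v - w) = 0"
    by (simp add: inner_diff_left)
  then show ?thesis by simp
qed

lemma grad_on_eqI:
  fixes S :: "'a::real_inner set"
  assumes "subspace S" "x \<in> S" "has_grad_on S f x v"
  shows "grad_on S f x = v"
  unfolding grad_on_def using assms has_grad_on_unique by blast

text \<open>The derivative is represented by some vector of the whole space; its orthogonal
  projection onto \<open>S\<close> acts in the same way on directions in \<open>S\<close>.\<close>

lemma has_grad_on_grad_on:
  fixes S :: "'a::euclidean_space set"
  assumes S: "subspace S" and x: "x \<in> S" and "f differentiable (at x within S)"
  shows "has_grad_on S f x (grad_on S f x)"
proof -
  obtain f' where f': "(f has_derivative f') (at x within S)"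
    using assms(3) unfolding differentiable_def by blast
  define v where "v = adjoint f' (1::real)"
  have lin: "linear f'"
    using f' by (rule has_derivative_linear)
  have v: "f' h = v \<bullet> h" for h
    using adjoint_works[OF lin, of h 1] unfolding v_def by (simp add: inner_commute)
  obtain p r where p: "p \<in> span S" "\<And>w. w \<in> span S \<Longrightarrow> orthogonal r w" "v = p + r"
    using orthogonal_subspace_decomp_exists by blast
  have "f' (y - x) = p \<bullet> (y - x)" if "y \<in> S" for y
  proof -
    have "y - x \<in> span S"
      using S x that by (simp add: span_base subspace_diff)
    then have "r \<bullet> (y - x) = 0"
      using p(2) by (simp add: orthogonal_def)
    then show ?thesis
      by (simp add: v p(3) inner_add_left)
  qed
  then have "(f has_derivative (\<lambda>h. p \<bullet> h)) (at x within S)"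
    using f' x unfolding has_derivative_within
    by (auto simp: bounded_linear_inner_right eventually_at_filter elim!: Lim_transform_eventually)
  moreover have "p \<in> S"
    using p(1) S by (simp add: span_eq_iff[THEN iffD2])
  ultimately have "has_grad_on S f x p"
    by (simp add: has_grad_on_def)
  then show ?thesis
    using grad_on_eqI[OF S x] by metis
qed

lemma has_derivative_within_squeeze:
  fixes f :: "'a::real_normed_vector \<Rightarrow> real"
  assumes lo: "(lo has_derivative D) (at x within S)" and up: "(up has_derivative D) (at x within S)"
    and "\<And>y. y \<in> S \<Longrightarrow> lo y \<le> f y" "\<And>y. y \<in> S \<Longrightarrow> f y \<le> up y"
    and "lo x = f x" "up x = f x"
  shows "(f has_derivative D) (at x within S)"
proof -
  define q where "q h y = (1 / norm (y - x)) *\<^sub>R (h y - (h x + D (y - x)))" for h :: "'a \<Rightarrow> real" and y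
  have "(q f \<longlongrightarrow> 0) (at x within S)"
  proof (rule tendsto_sandwich[of "q lo" _ _ "q up"])
    show "(q lo \<longlongrightarrow> 0) (at x within S)" "(q up \<longlongrightarrow> 0) (at x within S)"
      using lo up by (simp_all add: has_derivative_within q_def[abs_def])
    show "\<forall>\<^sub>F y in at x within S. q lo y \<le> q f y" "\<forall>\<^sub>F y in at x within S. q f y \<le> q up y"
      by (auto simp: eventually_at_filter q_def assms
          intro!: always_eventually mult_left_mono divide_right_mono)
  qed
  then show ?thesis
    using lo by (simp add: has_derivative_within q_def[abs_def])
qed

text \<open>The descent lemma: along the segment from \<open>x\<close> to \<open>y\<close>, the gap
  between \<open>f\<close> and its quadratic bound is monotone, by the Lipschitz bound and
  Cauchy-Schwarz.\<close>

lemma smooth_upper_bound: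
  fixes S :: "'a::euclidean_space set"
  assumes S: "subspace S" and g: "\<And>x. x \<in> S \<Longrightarrow> has_grad_on S f x (g x)"
    and L: "L-lipschitz_on S g" and x: "x \<in> S" and y: "y \<in> S"
  shows "f y \<le> f x + g x \<bullet> (y - x) + L / 2 * (norm (y - x))\<^sup>2"
proof -
  define h where "h = y - x"
  have h: "h \<in> S"
    using S x y by (simp add: h_def subspace_diff)
  have line: "x + t *\<^sub>R h \<in> S" for t
    using S x h by (auto intro: subspace_add subspace_scale)
  define k where "k t = f (x + t *\<^sub>R h) - t * (g x \<bullet> h) - L / 2 * t\<^sup>2 * (norm h)\<^sup>2" for t
  have "k 1 \<le> k 0"
  proof (rule DERIV_nonpos_imp_nonincreasing[of 0 1 k])
    fix t :: real assume t: "0 \<le> t" "t \<le> 1"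
    have "(k has_real_derivative g (x + t *\<^sub>R h) \<bullet> h - g x \<bullet> h - L * t * (norm h)\<^sup>2) (at t)"
      unfolding k_def using has_grad_on_line[OF S x h g[OF line]]
      by (auto intro!: derivative_eq_intros)
    moreover have "g (x + t *\<^sub>R h) \<bullet> h - g x \<bullet> h \<le> L * t * (norm h)\<^sup>2"
    proof -
      have "g (x + t *\<^sub>R h) \<bullet> h - g x \<bullet> h = (g (x + t *\<^sub>R h) - g x) \<bullet> h"
        by (simp add: inner_diff_left)
      also have "\<dots> \<le> norm (g (x + t *\<^sub>R h) - g x) * norm h"
        by (rule norm_cauchy_schwarz)
      also have "norm (g (x + t *\<^sub>R h) - g x) \<le> L * norm (t *\<^sub>R h)"
        using lipschitz_onD[OF L line x, of t] by (simp add: dist_norm)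
      finally show ?thesis
        using t by (simp add: mult_right_mono power2_eq_square mult.assoc)
    qed
    ultimately show "\<exists>d. (k has_real_derivative d) (at t) \<and> d \<le> 0"
      by fastforce
  qed simp
  then show ?thesis
    by (simp add: k_def h_def algebra_simps)
qed

section \<open>Strongly convex programs with independent affine constraints\<close>

text \<open>Full rank makes the vectors independent, so the component \<open>r\<close> of
  \<open>a k\<close> orthogonal to all the others is nonzero; dividing it by
  \<open>r \<bullet> r\<close> normalises the product with \<open>a k\<close>.\<close>

lemma dual_vectors_exist:
  fixes a :: "'l \<Rightarrow> 'a::euclidean_space"
  assumes S: "subspace S" and fin: "finite L" and rank: "dim (a ` L) = card L"
    and aS: "\<And>l. l \<in> L \<Longrightarrow> a l \<in> S"
  obtains w where "\<And>k. k \<in> L \<Longrightarrow> w k \<in> S" "\<And>l k. \<lbrakk>l \<in> L; k \<in> L\<rbrakk> \<Longrightarrow> a l \<bullet> w k = of_bool (l = k)"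
proof -
  have "\<exists>w\<in>S. \<forall>l\<in>L. a l \<bullet> w = of_bool (l = k)" if k: "k \<in> L" for k
  proof -
    let ?B = "a ` (L - {k})"
    have notin: "a k \<notin> span ?B"
    proof
      assume "a k \<in> span ?B"
      then have "a l \<in> span ?B" if "l \<in> L" for l
        using that by (cases "l = k") (auto intro: span_base)
      then have "dim (a ` L) \<le> card ?B"
        using fin by (intro dim_le_card) auto
      also have "\<dots> \<le> card (L - {k})"
        using fin by (simp add: card_image_le)
      also have "\<dots> < card L"
        using fin k by (meson card_Diff1_less)
      finally show False
        using rank by simp
    qed
    obtain p r where p: "p \<in> span ?B" "\<And>b. b \<in> span ?B \<Longrightarrow> orthogonal r b" "a k = p + r"
      using orthogonal_subspace_decomp_exists by blast
    have "r \<noteq> 0"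
      using notin p by auto
    have "span ?B \<subseteq> S"
      using S aS by (intro span_minimal) auto
    then have "r \<in> S"
      using S aS[OF k] p(1,3) subspace_diff[of S "a k" p] by auto
    moreover have "a k \<bullet> r = r \<bullet> r"
      using p(1) p(2)[of p] by (simp add: p(3) inner_add_left inner_add_right orthogonal_def inner_commute)
    moreover have "a l \<bullet> r = 0" if "l \<in> L" "l \<noteq> k" for l
      using p(2)[of "a l"] that by (simp add: orthogonal_def inner_commute span_base)
    ultimately show ?thesis
      using S \<open>r \<noteq> 0\<close> by (intro bexI[of _ "(1 / (r \<bullet> r)) *\<^sub>R r"]) (auto simp: subspace_scale)
  qed
  then show ?thesis
    using that by metis
qed

text \<open>A negative directional derivative would make \<open>f\<close> decrease for all small
  \<open>t\<close>, contradicting minimality on a short initial piece of the ray.\<close>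

lemma has_grad_on_feasible_direction:
  fixes S :: "'a::real_inner set"
  assumes S: "subspace S" "x \<in> S" "d \<in> S" and v: "has_grad_on S f x v"
    and "\<epsilon> > 0" and min: "\<And>t. \<lbrakk>0 < t; t < \<epsilon>\<rbrakk> \<Longrightarrow> f x \<le> f (x + t *\<^sub>R d)"
  shows "v \<bullet> d \<ge> 0"
proof (rule ccontr)
  assume "\<not> v \<bullet> d \<ge> 0"
  moreover have "((\<lambda>t. f (x + t *\<^sub>R d)) has_real_derivative v \<bullet> d) (at 0)"
    using has_grad_on_line[OF S, of f 0] v by simp
  ultimately obtain \<delta> where "\<delta> > 0" and \<delta>: "\<And>t. \<lbrakk>0 < t; t < \<delta>\<rbrakk> \<Longrightarrow> f (x + t *\<^sub>R d) < f x"
    using DERIV_neg_dec_right[of "\<lambda>t. f (x + t *\<^sub>R d)" "v \<bullet> d" 0] by fastforce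
  obtain t where "0 < t" "t < min \<epsilon> \<delta>"
    using \<open>\<epsilon> > 0\<close> \<open>\<delta> > 0\<close> dense[of 0 "min \<epsilon> \<delta>"] by auto
  then show False
    using min[of t] \<delta>[of t] by simp
qed

text \<open>
  Moving along the dual vector of one constraint changes the left-hand side of this constraint only,
  so the multiplier of a constraint is the negated derivative of the cost along its dual vector.
\<close>

lemma KKT_multipliers_exist:
  fixes a :: "'l \<Rightarrow> 'a::euclidean_space"
  assumes S: "subspace S" and fin: "finite L" and rank: "dim (a ` L) = card L"
    and aS: "\<And>l. l \<in> L \<Longrightarrow> a l \<in> S"
    and F: "F = {x \<in> S. \<forall>l\<in>L. (if l \<in> I then a l \<bullet> x + c l \<le> 0 else a l \<bullet> x + c l = 0)}"
    and x: "x \<in> F" and min: "\<And>y. y \<in> F \<Longrightarrow> f x \<le> f y" and v: "has_grad_on S f x v"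
  obtains u where "v + (\<Sum>l\<in>L. u l *\<^sub>R a l) = 0"
    and "\<And>l. \<lbrakk>l \<in> L; l \<in> I\<rbrakk> \<Longrightarrow> u l \<ge> 0 \<and> u l * (a l \<bullet> x + c l) = 0"
proof -
  obtain w where wS: "\<And>k. k \<in> L \<Longrightarrow> w k \<in> S"
    and w: "\<And>l k. \<lbrakk>l \<in> L; k \<in> L\<rbrakk> \<Longrightarrow> a l \<bullet> w k = of_bool (l = k)"
    using dual_vectors_exist[OF S fin rank aS] by blast
  have xS: "x \<in> S" and vS: "v \<in> S"
    using x v by (auto simp: F has_grad_on_def)
  have step: "x + t *\<^sub>R d \<in> S" if "d \<in> S" for t d
    using S xS that by (simp add: subspace_add subspace_scale)
  define u where "u l = - (v \<bullet> w l)" for l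
  \<comment> \<open>The residual \<open>r\<close> of the stationarity condition is orthogonal to
    every \<open>w k\<close> by the choice of \<open>u\<close>. Its correction \<open>d\<close> is
    orthogonal to every \<open>a k\<close>, so moving along \<open>d\<close> or \<open>- d\<close>
    changes no constraint.\<close>
  define r where "r = v + (\<Sum>l\<in>L. u l *\<^sub>R a l)"
  define d where "d = r - (\<Sum>l\<in>L. (a l \<bullet> r) *\<^sub>R w l)"
  have rS: "r \<in> S"
    unfolding r_def using S vS aS by (intro subspace_add subspace_sum subspace_scale) auto
  have dS: "d \<in> S"
    unfolding d_def using S rS wS by (intro subspace_diff subspace_sum subspace_scale) auto
  have ad: "a k \<bullet> d = 0" if "k \<in> L" for k
    using that fin by (simp add: d_def inner_diff_right inner_sum_right w if_distrib[of "(*) _"] of_bool_def cong: if_cong)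
  have rw: "r \<bullet> w k = 0" if "k \<in> L" for k
    using that fin
    by (simp add: r_def inner_add_left inner_diff_left inner_sum_left w u_def sum_negf
        if_distrib[of "(*) _"] of_bool_def cong: if_cong)
  have "v \<bullet> d \<ge> 0"
  proof (rule has_grad_on_feasible_direction[OF S xS dS v zero_less_one])
    fix t :: real
    show "f x \<le> f (x + t *\<^sub>R d)"
      using x step[OF dS] ad by (intro min) (auto simp: F inner_add_right)
  qed
  moreover have "v \<bullet> (- d) \<ge> 0"
  proof (rule has_grad_on_feasible_direction[OF S xS _ v zero_less_one])
    show "- d \<in> S"
      using S dS by (rule subspace_neg)
    then show "f x \<le> f (x + t *\<^sub>R (- d))" for t
      using x step ad by (intro min) (auto simp: F inner_add_right inner_diff_right simp flip: scaleR_minus_right)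
  qed
  ultimately have "v \<bullet> d = 0" by simp
  then have "r \<bullet> d = 0"
    using ad by (simp add: r_def inner_add_left inner_sum_left)
  \<comment> \<open>As \<open>r\<close> is orthogonal to all \<open>w k\<close>, the product
    \<open>r \<bullet> d\<close> equals \<open>r \<bullet> r\<close>.\<close>
  then have "r = 0"
    using rw by (simp add: d_def inner_diff_right inner_sum_right)
  moreover have "u k \<ge> 0 \<and> u k * (a k \<bullet> x + c k) = 0" if k: "k \<in> L" "k \<in> I" for k
  proof -
    \<comment> \<open>Moving along \<open>- w k\<close> lowers the left-hand side of the inequality
      \<open>k\<close> and leaves the others alone, hence stays feasible.\<close>
    have "v \<bullet> (- w k) \<ge> 0"
    proof (rule has_grad_on_feasible_direction[OF S xS _ v zero_less_one])
      show mS: "- w k \<in> S"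
        using S wS[OF k(1)] by (rule subspace_neg)
      fix t :: real assume "0 < t"
      have "a l \<bullet> (x + t *\<^sub>R (- w k)) = a l \<bullet> x - t * of_bool (l = k)" if "l \<in> L" for l
        using w[OF that k(1)] by (simp add: inner_add_right inner_diff_right)
      then show "f x \<le> f (x + t *\<^sub>R (- w k))"
        using x step[OF mS, of t] k \<open>0 < t\<close> by (intro min) (fastforce simp: F)
    qed
    then have nonneg: "u k \<ge> 0"
      by (simp add: u_def)
    \<comment> \<open>Complementary slackness: an inactive inequality also admits the direction
      \<open>w k\<close>, until its slack is used up.\<close>
    have "u k = 0" if inactive: "a k \<bullet> x + c k \<noteq> 0"
    proof -
      have less: "a k \<bullet> x + c k < 0"
        using x k inactive by (fastforce simp: F)
      have "v \<bullet> w k \<ge> 0"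
      proof (rule has_grad_on_feasible_direction[OF S xS wS[OF k(1)] v])
        show "0 < - (a k \<bullet> x + c k)"
          using less by simp
        fix t :: real assume t: "0 < t" "t < - (a k \<bullet> x + c k)"
        have "a l \<bullet> (x + t *\<^sub>R w k) = a l \<bullet> x + t * of_bool (l = k)" if "l \<in> L" for l
          using w[OF that k(1)] by (simp add: inner_add_right)
        then show "f x \<le> f (x + t *\<^sub>R w k)"
          using x step[OF wS[OF k(1)], of t] k t by (intro min) (fastforce simp: F)
      qed
      then show ?thesis
        using nonneg by (simp add: u_def)
    qed
    then show ?thesis
      using nonneg by auto
  qed
  ultimately show ?thesis
    using that[of u] by (auto simp: r_def)
qed

text \<open>Strong convexity gives coercivity: outside the ball of radius \<open>R\<close> the
  quadratic term dominates the linear one and \<open>f\<close> is at least \<open>f x0\<close>, so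
  minimising over a compact part of \<open>F\<close> suffices.\<close>

lemma strongly_convex_attains_inf:
  fixes S :: "'a::euclidean_space set"
  assumes "\<nu> > 0" and conv: "strongly_convex_on S \<nu> f" and cont: "continuous_on S f"
    and "closed F" "F \<subseteq> S" "F \<noteq> {}"
  obtains x where "x \<in> F" "\<And>y. y \<in> F \<Longrightarrow> f x \<le> f y"
proof -
  obtain x0 where x0: "x0 \<in> F"
    using \<open>F \<noteq> {}\<close> by blast
  define g where "g = grad_on S f x0"
  define R where "R = 2 * norm g / \<nu>"
  have R: "R \<ge> 0"
    using \<open>\<nu> > 0\<close> by (simp add: R_def)
  have "compact (F \<inter> cball x0 R)"
    using \<open>closed F\<close> by (simp add: closed_Int_compact)
  moreover have "F \<inter> cball x0 R \<noteq> {}"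
    using x0 R by auto
  moreover have "continuous_on (F \<inter> cball x0 R) f"
    using cont \<open>F \<subseteq> S\<close> by (meson continuous_on_subset inf_le1 order_trans)
  ultimately obtain x where x: "x \<in> F \<inter> cball x0 R"
      and min: "\<And>y. y \<in> F \<inter> cball x0 R \<Longrightarrow> f x \<le> f y"
    by (metis continuous_attains_inf)
  have "f x \<le> f y" if y: "y \<in> F" for y
  proof (cases "y \<in> cball x0 R")
    case False
    let ?n = "norm (y - x0)"
    have n: "R < ?n"
      using False by (simp add: dist_norm norm_minus_commute)
    have "g \<bullet> (y - x0) + \<nu> / 2 * ?n\<^sup>2 \<le> f y - f x0"
      using conv x0 y \<open>F \<subseteq> S\<close> by (auto simp: strongly_convex_on_def g_def)
    moreover have "- (norm g * ?n) \<le> g \<bullet> (y - x0)"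
      using Cauchy_Schwarz_ineq2[of g "y - x0"] by linarith
    moreover have "norm g * ?n \<le> \<nu> / 2 * ?n\<^sup>2"
    proof -
      have "norm g \<le> \<nu> / 2 * ?n"
        using n \<open>\<nu> > 0\<close> by (simp add: R_def field_simps)
      then show ?thesis
        using mult_right_mono[of "norm g" "\<nu> / 2 * ?n" ?n] by (simp add: power2_eq_square mult.assoc)
    qed
    ultimately have "f x0 \<le> f y" by linarith
    moreover have "f x \<le> f x0"
      using min x0 R by simp
    ultimately show ?thesis by linarith
  qed (use min y in auto)
  then show ?thesis
    using that x by blast
qed

section \<open>Weighted Laplacians of connected graphs\<close>

text \<open>
  By the maximum principle the kernel of the symmetric map \<open>I - P\<close> consists of the vectors constant
  on \<open>V\<close>; the range is its orthogonal complement.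
\<close>

lemma laplacian_range:
  fixes p :: "'v::finite \<Rightarrow> 'v \<Rightarrow> real" and r :: "'v \<Rightarrow> real"
  assumes sym: "\<And>i j. \<lbrakk>i \<in> V; j \<in> V\<rbrakk> \<Longrightarrow> p i j = p j i"
    and nonneg: "\<And>i j. \<lbrakk>i \<in> V; j \<in> V\<rbrakk> \<Longrightarrow> p i j \<ge> 0"
    and pos: "\<And>i j. (i, j) \<in> R \<Longrightarrow> i \<in> V \<and> j \<in> V \<and> p i j > 0"
    and row: "\<And>i. i \<in> V \<Longrightarrow> (\<Sum>j\<in>V. p i j) = 1"
    and conn: "\<And>i j. \<lbrakk>i \<in> V; j \<in> V\<rbrakk> \<Longrightarrow> (i, j) \<in> R\<^sup>*"
    and r: "(\<Sum>i\<in>V. r i) = 0"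
  obtains y :: "real^'v" where "\<And>i. i \<notin> V \<Longrightarrow> y $ i = 0"
    and "\<And>i. i \<in> V \<Longrightarrow> y $ i - (\<Sum>j\<in>V. p i j * y $ j) = r i"
proof -
  define T :: "real^'v \<Rightarrow> real^'v" where
    "T y = (\<chi> i. if i \<in> V then y $ i - (\<Sum>j\<in>V. p i j * y $ j) else 0)" for y
  have lin: "linear T"
    by (rule linearI) (auto simp: T_def vec_eq_iff sum.distrib sum_distrib_left algebra_simps)
  have inner: "x \<bullet> T y = (\<Sum>i\<in>V. x $ i * y $ i) - (\<Sum>i\<in>V. \<Sum>j\<in>V. p i j * x $ i * y $ j)" for x y
  proof -
    have "x \<bullet> T y = (\<Sum>i\<in>UNIV. if i \<in> V then x $ i * (y $ i - (\<Sum>j\<in>V. p i j * y $ j)) else 0)"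
      by (auto simp: inner_vec_def T_def intro!: sum.cong)
    also have "\<dots> = (\<Sum>i\<in>V. x $ i * (y $ i - (\<Sum>j\<in>V. p i j * y $ j)))"
      by (simp add: sum.If_cases)
    finally show ?thesis
      by (simp add: algebra_simps sum_subtractf sum_distrib_left)
  qed
  have self_adj: "x \<bullet> T y = T x \<bullet> y" for x y
  proof -
    have "(\<Sum>i\<in>V. \<Sum>j\<in>V. p i j * x $ i * y $ j) = (\<Sum>i\<in>V. \<Sum>j\<in>V. p i j * y $ i * x $ j)"
      by (subst sum.swap) (auto intro!: sum.cong simp: sym)
    then show ?thesis
      by (simp add: inner_commute[of "T x"] inner mult.commute)
  qed
  have kernel: "y $ i = y $ k" if "T y = 0" "i \<in> V" "k \<in> V" for y i k
  proof -
    define M where "M = Max ((\<lambda>i. y $ i) ` V)"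
    have le: "y $ j \<le> M" if "j \<in> V" for j
      using that by (simp add: M_def)
    have "M \<in> (\<lambda>i. y $ i) ` V"
      unfolding M_def using \<open>i \<in> V\<close> by (intro Max_in) auto
    then obtain i0 where i0: "i0 \<in> V" "y $ i0 = M"
      by auto
    \<comment> \<open>At a vertex with the maximal value, that value is a weighted average of values
      at most \<open>M\<close>, so every positively weighted neighbour attains it too. Connectedness
      spreads it over \<open>V\<close>.\<close>
    have spread: "y $ b = M" if "(a, b) \<in> R" "y $ a = M" for a b
    proof -
      have ab: "a \<in> V" "b \<in> V" "p a b > 0"
        using pos that by auto
      have "T y $ a = 0"
        using \<open>T y = 0\<close> by simp
      then have "M = (\<Sum>j\<in>V. p a j * y $ j)"
        using ab that(2) by (simp add: T_def)
      moreover have "M = (\<Sum>j\<in>V. p a j * M)"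
        using row[OF ab(1)] by (simp flip: sum_distrib_right)
      ultimately have "(\<Sum>j\<in>V. p a j * (M - y $ j)) = 0"
        by (simp add: right_diff_distrib sum_subtractf)
      then have "p a b * (M - y $ b) = 0"
        using ab le nonneg by (subst (asm) sum_nonneg_eq_0_iff) auto
      then show ?thesis
        using ab by simp
    qed
    have "y $ j = M" if "j \<in> V" for j
      using conn[OF i0(1) that] by (induction rule: rtrancl_induct) (use i0 spread in auto)
    then show ?thesis
      using that by simp
  qed
  define rv :: "real^'v" where "rv = (\<chi> i. if i \<in> V then r i else 0)"
  obtain q s where q: "q \<in> span (range T)" "\<And>w. w \<in> span (range T) \<Longrightarrow> orthogonal s w" "rv = q + s"
    using orthogonal_subspace_decomp_exists by blast
  have range: "span (range T) = range T"
    using lin by (simp add: linear_subspace_image)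
  \<comment> \<open>Self-adjointness puts the part \<open>s\<close> orthogonal to the range into the
    kernel. Thus \<open>s\<close> is constant on \<open>V\<close>, hence orthogonal to the zero-sum
    vector \<open>rv\<close>, and vanishes.\<close>
  have "T s \<bullet> T s = 0"
    using q(2)[of "T (T s)"] range by (simp add: orthogonal_def self_adj)
  then have "T s = 0" by simp
  have "s \<bullet> rv = (\<Sum>i\<in>V. s $ i * r i)"
    by (simp add: inner_vec_def rv_def if_distrib[of "(*) _"] sum.If_cases cong: if_cong)
  also have "\<dots> = 0"
  proof (cases "V = {}")
    case False
    then obtain k where "k \<in> V" by blast
    then have "(\<Sum>i\<in>V. s $ i * r i) = (\<Sum>i\<in>V. s $ k * r i)"
      using kernel[OF \<open>T s = 0\<close> _ \<open>k \<in> V\<close>] by (intro sum.cong refl) metis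
    then show ?thesis
      using r by (simp flip: sum_distrib_left)
  qed simp
  finally have "s \<bullet> s = 0"
    using q by (simp add: inner_add_right orthogonal_def)
  then have "rv \<in> range T"
    using q range by simp
  then obtain y where y: "rv = T y" by blast
  show ?thesis
  proof (rule that[of "\<chi> i. if i \<in> V then y $ i else 0"])
    fix i assume "i \<in> V"
    moreover have "rv $ i = T y $ i"
      using y by simp
    ultimately show "(\<chi> i. if i \<in> V then y $ i else 0) $ i - (\<Sum>j\<in>V. p i j * (\<chi> i. if i \<in> V then y $ i else 0) $ j) = r i"
      by (simp add: rv_def T_def)
  qed simp
qed

section \<open>One step of accelerated dual averaging\<close>

text \<open>The condition on \<open>L\<close> makes the descent from \<open>y\<close> to
  \<open>yh'\<close> at least \<open>c\<^sup>2 / (2 * \<Gamma>)\<close> times the squared norm of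
  \<open>g\<close>. Weighted by \<open>\<Gamma>\<close>, it pays for the quadratic term in the
  expanded distance from \<open>u\<close> to \<open>z'\<close>; convexity at \<open>yh\<close> and
  \<open>u\<close> bounds the linear term.\<close>

lemma dual_averaging_step:
  fixes y z z' yh yh' u g :: "'a::real_inner" and \<phi> :: "'a \<Rightarrow> real"
  assumes "c > 0" "G \<ge> 0" and \<Gamma>: "\<Gamma> = G + c" and L: "L * c\<^sup>2 \<le> \<Gamma>"
    and y: "\<Gamma> *\<^sub>R y = G *\<^sub>R yh + c *\<^sub>R z" and z': "z' = z - c *\<^sub>R g"
    and yh': "\<Gamma> *\<^sub>R yh' = G *\<^sub>R yh + c *\<^sub>R z'"
    and smooth: "\<phi> yh' \<le> \<phi> y + g \<bullet> (yh' - y) + L / 2 * (norm (yh' - y))\<^sup>2"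
    and convex: "\<phi> yh \<ge> \<phi> y + g \<bullet> (yh - y)" "\<phi> u \<ge> \<phi> y + g \<bullet> (u - y)"
  shows "\<Gamma> * (\<phi> yh' - \<phi> u) + (norm (u - z'))\<^sup>2 / 2 \<le> G * (\<phi> yh - \<phi> u) + (norm (u - z))\<^sup>2 / 2"
proof -
  have "\<Gamma> > 0"
    using assms by simp
  define n where "n = g \<bullet> g"
  \<comment> \<open>The points \<open>y\<close> and \<open>yh'\<close> are the same weighted mean,
    once with \<open>z\<close> and once with \<open>z'\<close>; they differ by a gradient step of
    length \<open>c\<^sup>2 / \<Gamma>\<close>.\<close>
  have "\<Gamma> *\<^sub>R (yh' - y) = - (c\<^sup>2) *\<^sub>R g"
    by (simp add: scaleR_diff_right yh' y z' power2_eq_square)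
  then have "(1 / \<Gamma>) *\<^sub>R (\<Gamma> *\<^sub>R (yh' - y)) = (1 / \<Gamma>) *\<^sub>R (- (c\<^sup>2) *\<^sub>R g)"
    by simp
  then have d: "yh' - y = - (c\<^sup>2 / \<Gamma>) *\<^sub>R g"
    using \<open>\<Gamma> > 0\<close> by simp
  have "\<phi> yh' \<le> \<phi> y - c\<^sup>2 / \<Gamma> * n + L / 2 * ((c\<^sup>2 / \<Gamma>)\<^sup>2 * n)"
    using smooth unfolding d
    by (simp add: n_def power_mult_distrib power_divide flip: power2_norm_eq_inner)
  then have "\<Gamma> * \<phi> yh' \<le> \<Gamma> * (\<phi> y - c\<^sup>2 / \<Gamma> * n + L / 2 * ((c\<^sup>2 / \<Gamma>)\<^sup>2 * n))"
    using \<open>\<Gamma> > 0\<close> by (simp add: mult_left_mono)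
  also have "\<dots> = \<Gamma> * \<phi> y - c\<^sup>2 * n + (L * c\<^sup>2 / \<Gamma>) * (c\<^sup>2 * n / 2)"
    using \<open>\<Gamma> > 0\<close> by (simp add: field_simps power2_eq_square)
  also have "(L * c\<^sup>2 / \<Gamma>) * (c\<^sup>2 * n / 2) \<le> 1 * (c\<^sup>2 * n / 2)"
    using L \<open>\<Gamma> > 0\<close> by (intro mult_right_mono) (auto simp: n_def)
  finally have up: "\<Gamma> * \<phi> yh' \<le> \<Gamma> * \<phi> y - c\<^sup>2 * n / 2"
    by (simp add: mult.commute)
  have "(norm (u - z'))\<^sup>2 = (norm (u - z))\<^sup>2 + 2 * c * (g \<bullet> (u - z)) + c\<^sup>2 * n"
    unfolding z' n_def power2_norm_eq_inner
    by (simp add: inner_diff_left inner_diff_right inner_commute power2_eq_square algebra_simps)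
  moreover have "c * (g \<bullet> (u - z)) = c * (g \<bullet> (u - y)) + G * (g \<bullet> (yh - y))"
  proof -
    have "g \<bullet> (\<Gamma> *\<^sub>R y) = g \<bullet> (G *\<^sub>R yh + c *\<^sub>R z)"
      using y by simp
    then show ?thesis
      by (simp add: \<Gamma> inner_diff_right inner_add_right algebra_simps)
  qed
  moreover have "c * (g \<bullet> (u - y)) \<le> c * (\<phi> u - \<phi> y)" "G * (g \<bullet> (yh - y)) \<le> G * (\<phi> yh - \<phi> y)"
    using convex assms(1,2) by (auto intro!: mult_left_mono)
  ultimately show ?thesis
    using up by (simp add: \<Gamma> algebra_simps)
qed

section \<open>The coupled problem and its local problems\<close>

lemma subspace_coord_space: "subspace (coord_space D)"
  by (auto simp: subspace_def coord_space_def)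

lemma subspace_aux_space: "subspace (aux_space Pr)"
  by (auto simp: subspace_def aux_space_def)

lemma mult_grad_in_aux_space: "mult_grad Pr y \<in> aux_space Pr"
  by (simp add: mult_grad_def aux_space_def)

text \<open>For an affected agent this is an entry of (I - P) applied to the block \<open>l\<close>
  of \<open>y\<close>. The auxiliary variables enter the local constraints only through it.\<close>

definition laplacian ::
    "('v::finite, 'd::finite, 'm::finite, 'q::finite) problem \<Rightarrow> real^'v^('m + 'q) \<Rightarrow>
     'm + 'q \<Rightarrow> 'v \<Rightarrow> real" where
  "laplacian Pr y l i = y $ l $ i - (\<Sum>j\<in>affected Pr l. weight Pr l i j * y $ l $ j)"

lemma linear_laplacian: "linear (\<lambda>y. laplacian Pr y l i)"
  by (rule linearI) (auto simp: laplacian_def sum.distrib sum_distrib_left algebra_simps)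

lemmas laplacian_diff = linear_diff[OF linear_laplacian]

lemma local_lhs_eq:
  "local_lhs Pr i y x l = con_row Pr i l \<bullet> x + (laplacian Pr y l i + con_const Pr i l)"
  by (simp add: local_lhs_def laplacian_def)

text \<open>Both kinds of constraints are put under one index, in the form of the set
  \<open>F\<close> in \<open>KKT_multipliers_exist\<close> with \<open>range Inl\<close> as the set
  of inequalities.\<close>

lemma local_feasible_eq:
  "local_feasible Pr i y = {x \<in> agent_space Pr i. \<forall>l\<in>agent_cons Pr i.
     if l \<in> range Inl then con_row Pr i l \<bullet> x + (laplacian Pr y l i + con_const Pr i l) \<le> 0
     else con_row Pr i l \<bullet> x + (laplacian Pr y l i + con_const Pr i l) = 0}"
  unfolding local_feasible_def local_lhs_eq
  by (auto split: if_splits) (metis obj_sumE rangeI)+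

lemma closed_local_feasible: "closed (local_feasible Pr i y)"
proof -
  define C where "C l = {x. if l \<in> range Inl
      then con_row Pr i l \<bullet> x + (laplacian Pr y l i + con_const Pr i l) \<le> 0
      else con_row Pr i l \<bullet> x + (laplacian Pr y l i + con_const Pr i l) = 0}" for l
  have "closed (C l)" for l
    by (cases "l \<in> range Inl")
      (simp_all add: C_def closed_Collect_le closed_Collect_eq continuous_intros)
  moreover have "local_feasible Pr i y = agent_space Pr i \<inter> (\<Inter>l\<in>agent_cons Pr i. C l)"
    unfolding local_feasible_eq C_def by blast
  ultimately show ?thesis
    using closed_subspace[OF subspace_coord_space] by (auto intro!: closed_Int closed_INT)
qed

lemma sum_agent_cons_swap:
  fixes Pr :: "('v::finite, 'd::finite, 'm::finite, 'q::finite) problem"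
  shows "(\<Sum>i\<in>UNIV. \<Sum>l\<in>agent_cons Pr i. F i l) = (\<Sum>l\<in>UNIV. \<Sum>i\<in>affected Pr l. F i l)"
  using sum.swap_restrict[of UNIV UNIV F "\<lambda>i l. i \<in> affected Pr l"]
  by (simp add: agent_cons_def)

text \<open>Transposition moves I - P from the multipliers to the direction \<open>h\<close>;
  exchanging the sums then splits the expression into contributions of the single agents.\<close>

lemma mult_grad_inner:
  fixes Pr :: "('v::finite, 'd::finite, 'm::finite, 'q::finite) problem"
  shows "mult_grad Pr y \<bullet> h = (\<Sum>i\<in>UNIV. \<Sum>l\<in>agent_cons Pr i. kkt_mult Pr i y l * laplacian Pr h l i)"
proof -
  let ?c = "\<lambda>l i j. of_bool (i = j) - weight Pr l i j"
  have lap: "laplacian Pr h l i = (\<Sum>j\<in>affected Pr l. ?c l i j * h $ l $ j)"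
    if "i \<in> affected Pr l" for l i
    using that by (simp add: laplacian_def left_diff_distrib sum_subtractf of_bool_def
        if_distrib[of "\<lambda>x. x * _"] cong: if_cong)
  have "mult_grad Pr y \<bullet> h = (\<Sum>l\<in>UNIV. \<Sum>j\<in>UNIV. if j \<in> affected Pr l
      then (\<Sum>i\<in>affected Pr l. ?c l i j * kkt_mult Pr i y l) * h $ l $ j else 0)"
    by (auto simp: inner_vec_def mult_grad_def intro!: sum.cong)
  also have "\<dots> = (\<Sum>l\<in>UNIV. \<Sum>j\<in>affected Pr l. \<Sum>i\<in>affected Pr l.
      ?c l i j * kkt_mult Pr i y l * h $ l $ j)"
    by (simp add: sum.If_cases sum_distrib_right)
  also have "\<dots> = (\<Sum>l\<in>UNIV. \<Sum>i\<in>affected Pr l. \<Sum>j\<in>affected Pr l.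
      ?c l i j * kkt_mult Pr i y l * h $ l $ j)"
    by (intro sum.cong refl sum.swap)
  also have "\<dots> = (\<Sum>l\<in>UNIV. \<Sum>i\<in>affected Pr l. kkt_mult Pr i y l * laplacian Pr h l i)"
    by (intro sum.cong refl) (simp add: lap sum_distrib_left mult_ac)
  finally show ?thesis
    by (simp add: sum_agent_cons_swap)
qed

text \<open>These hypotheses suffice for the local problems and the derivative of
  \<open>phi\<close>. Connectedness enters in \<open>phi_le_cost\<close>, the Lipschitz constant of
  the gradient in \<open>dual_avg_bound\<close>.\<close>

locale coupled_problem =
  fixes Pr :: "('v::finite, 'd::finite, 'm::finite, 'q::finite) problem" and \<nu> :: real
  assumes rows: "\<And>i l. con_row Pr i l \<in> agent_space Pr i"
    and weights: "\<And>l. weights_ok Pr l"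
    and pos: "\<nu> > 0"
    and differentiable: "\<And>i. cost Pr i differentiable_on agent_space Pr i"
    and strongly_convex: "\<And>i. strongly_convex_on (agent_space Pr i) \<nu> (cost Pr i)"
    and full_rank: "\<And>i. full_row_rank Pr i"
begin

section \<open>Solvability and multipliers of the local problems\<close>

lemma dim_rows: "dim (con_row Pr i ` agent_cons Pr i) = card (agent_cons Pr i)"
  using full_rank by (simp add: full_row_rank_def)

lemma dual_rows:
  obtains w where "\<And>k. k \<in> agent_cons Pr i \<Longrightarrow> w k \<in> agent_space Pr i"
    and "\<And>l k. \<lbrakk>l \<in> agent_cons Pr i; k \<in> agent_cons Pr i\<rbrakk> \<Longrightarrow> con_row Pr i l \<bullet> w k = of_bool (l = k)"
  using dual_vectors_exist[OF subspace_coord_space finite dim_rows rows] by blast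

lemma has_grad_on_cost:
  assumes "x \<in> agent_space Pr i"
  shows "has_grad_on (agent_space Pr i) (cost Pr i) x (grad_on (agent_space Pr i) (cost Pr i) x)"
  using assms differentiable[of i] subspace_coord_space
  by (intro has_grad_on_grad_on) (auto simp: differentiable_on_def)

text \<open>Independent rows allow all left-hand sides to be prescribed at once; the witness built
  from the dual vectors makes each of them zero, whatever \<open>y\<close> is.\<close>

lemma local_feasible_nonempty: "local_feasible Pr i y \<noteq> {}"
proof -
  obtain w where w: "\<And>k. k \<in> agent_cons Pr i \<Longrightarrow> w k \<in> agent_space Pr i"
      "\<And>l k. \<lbrakk>l \<in> agent_cons Pr i; k \<in> agent_cons Pr i\<rbrakk> \<Longrightarrow> con_row Pr i l \<bullet> w k = of_bool (l = k)"
    using dual_rows[where i = i] by blast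
  define x where "x = (\<Sum>k\<in>agent_cons Pr i. - (laplacian Pr y k i + con_const Pr i k) *\<^sub>R w k)"
  have "x \<in> agent_space Pr i"
    unfolding x_def using w(1) by (intro subspace_sum subspace_scale subspace_coord_space) auto
  moreover have "con_row Pr i l \<bullet> x = - (laplacian Pr y l i + con_const Pr i l)"
    if "l \<in> agent_cons Pr i" for l
    using that
    by (simp add: x_def inner_sum_right w(2) of_bool_def sum_negf
        if_distrib[of "(*) _"] cong: if_cong del: minus_add_distrib)
  ultimately have "x \<in> local_feasible Pr i y"
    by (simp add: local_feasible_eq)
  then show ?thesis by blast
qed

lemma local_sol_is_arg_min: "is_arg_min (cost Pr i) (\<lambda>x. x \<in> local_feasible Pr i y) (local_sol Pr i y)"
proof -
  have "local_feasible Pr i y \<subseteq> agent_space Pr i"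
    by (auto simp: local_feasible_def)
  then obtain x where "x \<in> local_feasible Pr i y" "\<And>x'. x' \<in> local_feasible Pr i y \<Longrightarrow> cost Pr i x \<le> cost Pr i x'"
    using strongly_convex_attains_inf[OF pos strongly_convex
        differentiable_imp_continuous_on[OF differentiable] closed_local_feasible _ local_feasible_nonempty]
    by metis
  then have "is_arg_min (cost Pr i) (\<lambda>x. x \<in> local_feasible Pr i y) x"
    by (simp add: is_arg_min_linorder)
  then show ?thesis
    unfolding local_sol_def arg_min_def by (rule someI)
qed

lemma local_sol_feasible: "local_sol Pr i y \<in> local_feasible Pr i y"
  using local_sol_is_arg_min by (simp add: is_arg_min_linorder)

lemma local_sol_agent_space: "local_sol Pr i y \<in> agent_space Pr i"
  using local_sol_feasible by (simp add: local_feasible_eq)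

lemma phi_local_le: "x \<in> local_feasible Pr i y \<Longrightarrow> phi_local Pr i y \<le> cost Pr i x"
  using local_sol_is_arg_min by (simp add: is_arg_min_linorder phi_local_def)

lemma kkt_mult_is_kkt_mult: "is_kkt_mult Pr i y (local_sol Pr i y) (kkt_mult Pr i y)"
proof -
  have "cost Pr i (local_sol Pr i y) \<le> cost Pr i x" if "x \<in> local_feasible Pr i y" for x
    using phi_local_le[OF that] by (simp add: phi_local_def)
  then obtain u where
    "grad_on (agent_space Pr i) (cost Pr i) (local_sol Pr i y)
       + (\<Sum>l\<in>agent_cons Pr i. u l *\<^sub>R con_row Pr i l) = 0"
    "\<And>l. \<lbrakk>l \<in> agent_cons Pr i; l \<in> range Inl\<rbrakk> \<Longrightarrow> u l \<ge> 0 \<and>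
       u l * (con_row Pr i l \<bullet> local_sol Pr i y + (laplacian Pr y l i + con_const Pr i l)) = 0"
    by (rule KKT_multipliers_exist[OF subspace_coord_space finite dim_rows rows local_feasible_eq
        local_sol_feasible _ has_grad_on_cost[OF local_sol_agent_space]]) blast+
  then have "is_kkt_mult Pr i y (local_sol Pr i y) u"
    using local_sol_feasible by (simp add: is_kkt_mult_def local_lhs_eq)
  then show ?thesis
    unfolding kkt_mult_def by (rule someI[where P = "is_kkt_mult Pr i y (local_sol Pr i y)"])
qed

section \<open>Convexity and differentiability of the value function\<close>

lemma grad_cost_eq:
  "grad_on (agent_space Pr i) (cost Pr i) (local_sol Pr i y)
     = - (\<Sum>l\<in>agent_cons Pr i. kkt_mult Pr i y l *\<^sub>R con_row Pr i l)"
  using kkt_mult_is_kkt_mult[of i y] by (simp add: is_kkt_mult_def eq_neg_iff_add_eq_0)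

text \<open>Weak duality: the multipliers at \<open>y\<close> make the weighted left-hand sides zero
  at the solution for \<open>y\<close> and nonpositive at the one for \<open>y'\<close>.
  Stationarity turns the difference into the slope of the cost, which convexity bounds.\<close>

lemma phi_local_subgradient:
  "phi_local Pr i y + (\<Sum>l\<in>agent_cons Pr i. kkt_mult Pr i y l * laplacian Pr (y' - y) l i) \<le> phi_local Pr i y'"
proof -
  let ?x = "local_sol Pr i y" and ?x' = "local_sol Pr i y'" and ?u = "kkt_mult Pr i y"
  have "?u l * laplacian Pr (y' - y) l i \<le> - (?u l * (con_row Pr i l \<bullet> (?x' - ?x)))"
    if l: "l \<in> agent_cons Pr i" for l
  proof -
    have "?u l * local_lhs Pr i y' ?x' l \<le> 0 \<and> ?u l * local_lhs Pr i y ?x l = 0"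
    proof (cases l)
      case (Inl m)
      then show ?thesis
        using l kkt_mult_is_kkt_mult[of i y] local_sol_feasible[of i y']
        by (auto simp: is_kkt_mult_def local_feasible_def mult_nonneg_nonpos)
    next
      case (Inr q)
      then show ?thesis
        using l local_sol_feasible[of i y] local_sol_feasible[of i y']
        by (auto simp: local_feasible_def)
    qed
    then show ?thesis
      by (simp add: local_lhs_eq laplacian_diff inner_diff_right algebra_simps)
  qed
  then have "(\<Sum>l\<in>agent_cons Pr i. ?u l * laplacian Pr (y' - y) l i)
      \<le> (\<Sum>l\<in>agent_cons Pr i. - (?u l * (con_row Pr i l \<bullet> (?x' - ?x))))"
    by (rule sum_mono)
  also have "\<dots> = grad_on (agent_space Pr i) (cost Pr i) ?x \<bullet> (?x' - ?x)"
    by (simp add: grad_cost_eq inner_sum_left sum_negf)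
  also have "\<dots> \<le> cost Pr i ?x' - cost Pr i ?x"
  proof -
    have "0 \<le> \<nu> / 2 * (norm (?x' - ?x))\<^sup>2"
      using pos by simp
    then show ?thesis
      using strongly_convex[of i, unfolded strongly_convex_on_def, rule_format,
          OF local_sol_agent_space[of i y] local_sol_agent_space[of i y']]
      by linarith
  qed
  finally show ?thesis
    by (simp add: phi_local_def)
qed

text \<open>
  Shifting the local solution along the dual vectors of the rows compensates a change of \<open>y\<close>, so
  \<^term>\<open>phi_local Pr i\<close> lies between two functions with the same value and derivative at \<open>y\<close>.
\<close>

lemma phi_local_has_derivative:
  "(phi_local Pr i has_derivative
     (\<lambda>h. \<Sum>l\<in>agent_cons Pr i. kkt_mult Pr i y l * laplacian Pr h l i)) (at y within S)"
proof -
  let ?x = "local_sol Pr i y" and ?u = "kkt_mult Pr i y"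
  let ?g = "grad_on (agent_space Pr i) (cost Pr i) (local_sol Pr i y)"
  let ?D = "\<lambda>h. \<Sum>l\<in>agent_cons Pr i. ?u l * laplacian Pr h l i"
  obtain w where w: "\<And>k. k \<in> agent_cons Pr i \<Longrightarrow> w k \<in> agent_space Pr i"
      "\<And>l k. \<lbrakk>l \<in> agent_cons Pr i; k \<in> agent_cons Pr i\<rbrakk> \<Longrightarrow> con_row Pr i l \<bullet> w k = of_bool (l = k)"
    using dual_rows[where i = i] by blast
  \<comment> \<open>The linear shift of the solution whose effect on each row cancels that of
    changing \<open>y\<close> by \<open>h\<close>; all left-hand sides, and so feasibility, are
    preserved.\<close>
  define T where "T h = (\<Sum>k\<in>agent_cons Pr i. - laplacian Pr h k i *\<^sub>R w k)" for h
  have "linear T"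
    by (rule linearI) (simp_all add: T_def linear_add[OF linear_laplacian] linear_cmul[OF linear_laplacian]
        algebra_simps sum.distrib scaleR_sum_right sum_subtractf sum_negf)
  then have T: "(T has_derivative T) F" for F
    by (simp add: linear_imp_has_derivative)
  have linD: "linear ?D"
    by (rule linearI) (simp_all add: linear_add[OF linear_laplacian] linear_cmul[OF linear_laplacian]
        algebra_simps sum.distrib sum_distrib_left)
  have T_space: "T h \<in> agent_space Pr i" for h
    unfolding T_def using w(1) by (intro subspace_sum subspace_scale subspace_coord_space) auto
  have T_row: "con_row Pr i l \<bullet> T h = - laplacian Pr h l i" if "l \<in> agent_cons Pr i" for l h
    using that by (simp add: T_def inner_sum_right w(2) of_bool_def sum_negf if_distrib[of "(*) _"] cong: if_cong)
  have space: "?x + T h \<in> agent_space Pr i" for h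
    by (intro subspace_add subspace_coord_space local_sol_agent_space T_space)
  have D: "?g \<bullet> T h = ?D h" for h
    by (simp add: grad_cost_eq inner_sum_left T_row sum_negf)
  show ?thesis
  proof (rule has_derivative_within_squeeze)
    show "((\<lambda>y'. phi_local Pr i y + ?D (y' - y)) has_derivative ?D) (at y within S)"
      by (rule has_derivative_eq_rhs, rule has_derivative_add[OF has_derivative_const
            has_derivative_compose[OF _ linear_imp_has_derivative[OF linD]]])
        (auto intro!: derivative_eq_intros)
    have "((\<lambda>y'. ?x + T (y' - y)) has_derivative T) (at y within S)"
      by (rule has_derivative_eq_rhs, rule has_derivative_add[OF has_derivative_const
            has_derivative_compose[OF _ T]])
        (auto intro!: derivative_eq_intros)
    moreover have "(cost Pr i has_derivative (\<bullet>) ?g) (at (?x + T (y - y)) within (\<lambda>y'. ?x + T (y' - y)) ` S)"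
      using has_grad_on_cost[OF local_sol_agent_space, of i y] space linear_0[OF \<open>linear T\<close>]
      unfolding has_grad_on_def by (auto intro: has_derivative_subset)
    ultimately have "((\<lambda>y'. cost Pr i (?x + T (y' - y))) has_derivative (\<lambda>h. ?g \<bullet> T h)) (at y within S)"
      by (rule has_derivative_in_compose)
    then show "((\<lambda>y'. cost Pr i (?x + T (y' - y))) has_derivative ?D) (at y within S)"
      by (simp add: D)
    show "phi_local Pr i y + ?D (y' - y) \<le> phi_local Pr i y'" for y'
      by (rule phi_local_subgradient)
    have "local_lhs Pr i y' (?x + T (y' - y)) l = local_lhs Pr i y ?x l" if "l \<in> agent_cons Pr i" for y' l
      using that by (simp add: local_lhs_eq inner_add_right T_row laplacian_diff)
    then show "phi_local Pr i y' \<le> cost Pr i (?x + T (y' - y))" for y'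
      using local_sol_feasible[of i y] space by (intro phi_local_le) (simp add: local_feasible_def)
  qed (simp_all add: linear_0[OF linD] linear_0[OF \<open>linear T\<close>] phi_local_def)
qed

lemma phi_subgradient: "phi Pr y + mult_grad Pr y \<bullet> (y' - y) \<le> phi Pr y'"
  unfolding phi_def mult_grad_inner sum.distrib[symmetric]
  by (rule sum_mono) (rule phi_local_subgradient)

text \<open>Identifies what the agents compute from their multipliers with the true gradient, so
  that the Lipschitz hypothesis on \<open>grad_on\<close> applies to the algorithm.\<close>

lemma has_grad_on_phi: "has_grad_on (aux_space Pr) (phi Pr) y (mult_grad Pr y)"
proof -
  have "(phi Pr has_derivative (\<lambda>h. mult_grad Pr y \<bullet> h)) (at y within aux_space Pr)"
    unfolding mult_grad_inner phi_def[abs_def] by (rule has_derivative_sum) (rule phi_local_has_derivative)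
  then show ?thesis
    by (simp add: has_grad_on_def mult_grad_in_aux_space)
qed

section \<open>Feasibility for (P) and comparison of the optimal values\<close>

lemma weight_sym:
  "\<lbrakk>i \<in> affected Pr l; j \<in> affected Pr l\<rbrakk> \<Longrightarrow> weight Pr l i j = weight Pr l j i"
  using weights unfolding weights_ok_def by blast

lemma weight_row: "i \<in> affected Pr l \<Longrightarrow> (\<Sum>j\<in>affected Pr l. weight Pr l i j) = 1"
  using weights unfolding weights_ok_def by blast

lemma weight_nonneg:
  "\<lbrakk>i \<in> affected Pr l; j \<in> affected Pr l\<rbrakk> \<Longrightarrow> 0 \<le> weight Pr l i j"
  using weights unfolding weights_ok_def by (metis less_imp_le order_refl)

lemma weight_pos: "(i, j) \<in> induced_edges Pr l \<Longrightarrow> 0 < weight Pr l i j"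
  using weights unfolding weights_ok_def induced_edges_def nbrs_def by fastforce

text \<open>By symmetry the column sums of the weights are one as well.\<close>

lemma sum_laplacian: "(\<Sum>i\<in>affected Pr l. laplacian Pr y l i) = 0"
proof -
  have "(\<Sum>i\<in>affected Pr l. \<Sum>j\<in>affected Pr l. weight Pr l i j * y $ l $ j)
      = (\<Sum>j\<in>affected Pr l. \<Sum>i\<in>affected Pr l. weight Pr l i j * y $ l $ j)"
    by (rule sum.swap)
  also have "\<dots> = (\<Sum>j\<in>affected Pr l. (\<Sum>i\<in>affected Pr l. weight Pr l j i) * y $ l $ j)"
    unfolding sum_distrib_right by (intro sum.cong refl) (simp add: weight_sym)
  also have "\<dots> = (\<Sum>j\<in>affected Pr l. y $ l $ j)"
    by (simp add: weight_row)
  finally show ?thesis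
    by (simp add: laplacian_def sum_subtractf)
qed

definition total_lhs :: "('v \<Rightarrow> real^'d) \<Rightarrow> 'm + 'q \<Rightarrow> real" where
  "total_lhs x l = (\<Sum>i\<in>affected Pr l. con_row Pr i l \<bullet> x i + con_const Pr i l)"

lemma P_feasible_eq:
  "P_feasible Pr = {x. (\<forall>i. x i \<in> agent_space Pr i) \<and>
     (\<forall>m. total_lhs x (Inl m) \<le> 0) \<and> (\<forall>q. total_lhs x (Inr q) = 0)}"
proof -
  have "total_lhs x l = (\<Sum>i\<in>UNIV. con_row Pr i l \<bullet> x i + con_const Pr i l)" for x l
    unfolding total_lhs_def by (rule sum.mono_neutral_left) (auto simp: affected_def)
  then show ?thesis
    by (simp add: P_feasible_def less_eq_vec_def vec_eq_iff matrix_vector_mul_component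
        con_row_def con_const_def)
qed

text \<open>Summing the local constraints cancels the auxiliary variables. As \<open>y\<close> is
  arbitrary, no iterate violates the coupling constraints.\<close>

lemma local_sol_P_feasible: "(\<lambda>i. local_sol Pr i y) \<in> P_feasible Pr"
proof -
  have total: "total_lhs (\<lambda>i. local_sol Pr i y) l = (\<Sum>i\<in>affected Pr l. local_lhs Pr i y (local_sol Pr i y) l)" for l
    using sum_laplacian[of y l] by (simp add: total_lhs_def local_lhs_eq sum.distrib)
  show ?thesis
    using local_sol_feasible[of _ y] local_sol_agent_space
    by (auto simp: P_feasible_eq total local_feasible_def agent_cons_def intro!: sum_nonpos sum.neutral)
qed

lemma phi_le_cost:
  assumes connected: "\<And>l. induced_connected Pr l" and x: "x \<in> P_feasible Pr"
  obtains y where "y \<in> aux_space Pr" "phi Pr y \<le> (\<Sum>i\<in>UNIV. cost Pr i (x i))"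
proof -
  define s where "s i l = con_row Pr i l \<bullet> x i + con_const Pr i l" for i l
  \<comment> \<open>The equal share of each affected agent in the coupled left-hand side, which has
    the sign required locally. If no agent is affected, the total is an empty sum and the quotient
    is 0.\<close>
  define mean where "mean l = total_lhs x l / card (affected Pr l)" for l
  have "\<exists>y :: real^'v. (\<forall>i. i \<notin> affected Pr l \<longrightarrow> y $ i = 0) \<and> (\<forall>i\<in>affected Pr l.
      y $ i - (\<Sum>j\<in>affected Pr l. weight Pr l i j * y $ j) = mean l - s i l)" for l
  proof -
    \<comment> \<open>Redistributing to the mean keeps the total, which is the solvability condition
      for the Laplacian.\<close>
    have zero: "(\<Sum>i\<in>affected Pr l. mean l - s i l) = 0"
      by (cases "affected Pr l = {}") (auto simp: sum_subtractf mean_def s_def total_lhs_def)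
    obtain y :: "real^'v" where "\<And>i. i \<notin> affected Pr l \<Longrightarrow> y $ i = 0"
        "\<And>i. i \<in> affected Pr l \<Longrightarrow> y $ i - (\<Sum>j\<in>affected Pr l. weight Pr l i j * y $ j) = mean l - s i l"
    proof (rule laplacian_range[where V = "affected Pr l" and p = "weight Pr l"
          and R = "induced_edges Pr l" and r = "\<lambda>i. mean l - s i l"])
      show "i \<in> affected Pr l \<and> j \<in> affected Pr l \<and> 0 < weight Pr l i j"
        if "(i, j) \<in> induced_edges Pr l" for i j
        using that weight_pos[OF that] by (simp add: induced_edges_def)
      show "(i, j) \<in> (induced_edges Pr l)\<^sup>*" if "i \<in> affected Pr l" "j \<in> affected Pr l" for i j
        using connected that unfolding induced_connected_def by blast
    qed (use weight_sym weight_nonneg weight_row zero in blast)+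
    then show ?thesis by blast
  qed
  then obtain Y :: "'m + 'q \<Rightarrow> real^'v" where Y: "\<And>l i. i \<notin> affected Pr l \<Longrightarrow> Y l $ i = 0"
      "\<And>l i. i \<in> affected Pr l \<Longrightarrow> Y l $ i - (\<Sum>j\<in>affected Pr l. weight Pr l i j * Y l $ j) = mean l - s i l"
    by metis
  define y :: "real^'v^('m + 'q)" where "y = (\<chi> l. Y l)"
  have lhs: "local_lhs Pr i y (x i) l = mean l" if "l \<in> agent_cons Pr i" for i l
    using Y(2)[of i l] that by (simp add: local_lhs_eq laplacian_def y_def s_def agent_cons_def)
  have "mean (Inl m) \<le> 0" "mean (Inr q) = 0" for m q
    using x by (auto simp: P_feasible_eq mean_def divide_nonpos_nonneg)
  then have "x i \<in> local_feasible Pr i y" for i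
    using x lhs by (simp add: local_feasible_def P_feasible_eq)
  then have "phi Pr y \<le> (\<Sum>i\<in>UNIV. cost Pr i (x i))"
    unfolding phi_def by (intro sum_mono phi_local_le)
  moreover have "y \<in> aux_space Pr"
    using Y(1) by (simp add: aux_space_def y_def)
  ultimately show ?thesis
    using that by blast
qed

section \<open>Convergence of accelerated dual averaging\<close>

lemma dual_avg_bound:
  assumes lip: "L-lipschitz_on (aux_space Pr) (grad_on (aux_space Pr) (phi Pr))"
    and c: "\<And>t. c t > 0" "\<And>t. t \<ge> 1 \<Longrightarrow> L * (c t)\<^sup>2 \<le> Gam c t"
    and y0: "y0 \<in> aux_space Pr" and u: "u \<in> aux_space Pr"
    and "dual_avg Pr c y0 y0 (Suc n) = (y, z, yh)"
  shows "z \<in> aux_space Pr \<and> yh \<in> aux_space Pr \<and>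
    Gam c (Suc n) * (phi Pr yh - phi Pr u) + (norm (u - z))\<^sup>2 / 2 \<le> (norm (u - y0))\<^sup>2 / 2"
  using assms(6)
proof (induction n arbitrary: y z yh)
  \<comment> \<open>The gradient identity and the descent bound are derived before the case split
    and serve both cases of the induction.\<close>
  note S = subspace_aux_space[of Pr] mult_grad_in_aux_space[of Pr]
  have "grad_on (aux_space Pr) (phi Pr) y = mult_grad Pr y" if "y \<in> aux_space Pr" for y
    using grad_on_eqI[OF subspace_aux_space that has_grad_on_phi] .
  then have "L-lipschitz_on (aux_space Pr) (mult_grad Pr)"
    using lip by (simp cong: lipschitz_on_cong)
  note smooth = smooth_upper_bound[OF subspace_aux_space has_grad_on_phi this]
  {
    case 0
    then have z: "z = y0 - c 1 *\<^sub>R mult_grad Pr y0" "yh = z"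
      by (auto simp: Let_def)
    then have "z \<in> aux_space Pr"
      using S y0 by (auto intro: subspace_diff subspace_scale)
    \<comment> \<open>The first iteration is a general step with previous weight 0, in which
      \<open>y\<close>, the old \<open>z\<close> and the old average all equal \<open>y0\<close>;
      starting \<open>z\<close> at \<open>y0\<close> matters here.\<close>
    moreover have "Gam c 1 * (phi Pr yh - phi Pr u) + (norm (u - z))\<^sup>2 / 2
        \<le> 0 * (phi Pr y0 - phi Pr u) + (norm (u - y0))\<^sup>2 / 2"
      using calculation smooth[OF y0, of z] c(1)[of 1] c(2)[of 1] z phi_subgradient[of y0]
      by (intro dual_averaging_step[where y = y0 and g = "mult_grad Pr y0" and c = "c 1" and L = L])
        (auto simp: Gam_def)
    ultimately show ?case
      using z by simp
  next
    case (Suc n)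
    let ?t = "Suc (Suc n)"
    obtain y1 z1 yh1 where prev: "dual_avg Pr c y0 y0 (Suc n) = (y1, z1, yh1)"
      by (metis prod_cases3)
    note IH = Suc.IH[OF prev]
    define r where "r = c ?t / Gam c ?t"
    have Gam: "Gam c ?t = Gam c (Suc n) + c ?t"
      by (simp add: Gam_def)
    have "Gam c (Suc n) \<ge> 0"
      unfolding Gam_def using c(1) by (intro sum_nonneg) (simp add: less_imp_le)
    then have "Gam c ?t > 0"
      using c(1)[of ?t] Gam by simp
    then have r: "Gam c ?t * r = c ?t" "Gam c ?t * (1 - r) = Gam c (Suc n)"
      using Gam by (auto simp: r_def right_diff_distrib)
    have eqs: "y = (1 - r) *\<^sub>R yh1 + r *\<^sub>R z1" "z = z1 - c ?t *\<^sub>R mult_grad Pr y"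
        "yh = (1 - r) *\<^sub>R yh1 + r *\<^sub>R z"
      using Suc.prems prev by (auto simp: Let_def r_def)
    have y: "y \<in> aux_space Pr"
      unfolding eqs(1) using IH S by (auto intro!: subspace_add subspace_scale)
    have z: "z \<in> aux_space Pr"
      unfolding eqs(2) using IH S by (auto intro!: subspace_diff subspace_scale)
    have yh: "yh \<in> aux_space Pr"
      unfolding eqs(3) using IH S z by (auto intro!: subspace_add subspace_scale)
    \<comment> \<open>Clears the denominator in the convex combinations of the algorithm, matching
      the form of \<open>dual_averaging_step\<close>.\<close>
    have comb: "Gam c ?t *\<^sub>R ((1 - r) *\<^sub>R a + r *\<^sub>R b) = Gam c (Suc n) *\<^sub>R a + c ?t *\<^sub>R b"
      for a b :: "real^'v^('m + 'q)"
      by (simp add: scaleR_add_right r)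
    have "Gam c ?t * (phi Pr yh - phi Pr u) + (norm (u - z))\<^sup>2 / 2
        \<le> Gam c (Suc n) * (phi Pr yh1 - phi Pr u) + (norm (u - z1))\<^sup>2 / 2"
    proof (rule dual_averaging_step[OF c(1) \<open>Gam c (Suc n) \<ge> 0\<close> Gam c(2) _ eqs(2)])
      show "Gam c ?t *\<^sub>R y = Gam c (Suc n) *\<^sub>R yh1 + c ?t *\<^sub>R z1"
        using eqs(1) comb by simp
      show "Gam c ?t *\<^sub>R yh = Gam c (Suc n) *\<^sub>R yh1 + c ?t *\<^sub>R z"
        using eqs(3) comb by simp
    qed (use smooth[OF y yh] phi_subgradient in auto)
    then show ?case
      using IH z yh by linarith
  }
qed

end

section \<open>Linearly growing step sizes and the convergence rate\<close>

lemma Gam_linear: "Gam (\<lambda>t. \<gamma> * (real t + 1)) t = \<gamma> * (real t * (real t + 3)) / 2"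
  by (induction t) (auto simp: Gam_def algebra_simps)

theorem theorem1:
  fixes Pr :: "('v::finite, 'd::finite, 'm::finite, 'q::finite) problem"
    and \<nu> \<alpha> \<alpha>\<phi> \<gamma> :: real
    and y0 z0 ystar :: "real^'v^('m + 'q)"
    and xstar :: "'v \<Rightarrow> real^'d"
  assumes ineq_rows: "\<And>i m. ineq_mat Pr i $ m \<in> agent_space Pr i"
    and eq_rows: "\<And>i q. eq_mat Pr i $ q \<in> agent_space Pr i"
    and undirected: "sym (edges Pr)"
    and weights: "\<And>l. weights_ok Pr l"
    and connected: "\<And>l. induced_connected Pr l"
    and "\<nu> > 0" and "\<alpha> > 0"
    and differentiable: "\<And>i. cost Pr i differentiable_on agent_space Pr i"
    and strongly_convex: "\<And>i. strongly_convex_on (agent_space Pr i) \<nu> (cost Pr i)"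
    and lipschitz_grad:
      "\<And>i. \<alpha>-lipschitz_on (agent_space Pr i) (grad_on (agent_space Pr i) (cost Pr i))"
    and full_rank: "\<And>i. full_row_rank Pr i"
    and "\<alpha>\<phi> > 0"
    and lipschitz_phi: "\<alpha>\<phi>-lipschitz_on (aux_space Pr) (grad_on (aux_space Pr) (phi Pr))"
    and "0 < \<gamma>" and "\<gamma> \<le> 1 / (2 * \<alpha>\<phi>)"
    and "y0 \<in> aux_space Pr" and "z0 \<in> aux_space Pr"
    and ystar: "is_arg_min (phi Pr) (\<lambda>y. y \<in> aux_space Pr) ystar"
    and xstar: "P_optimal Pr xstar"
  shows "\<forall>t\<ge>2.
    let \<gamma>s = (\<lambda>t. \<gamma> * (real t + 1));
        x = (\<lambda>i. local_sol Pr i (yhat Pr \<gamma>s z0 y0 t))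
    in x \<in> P_feasible Pr \<and>
       (z0 = y0 \<longrightarrow>
         (\<Sum>i\<in>UNIV. cost Pr i (x i) - cost Pr i (xstar i))
           \<le> (norm (y0 - ystar))\<^sup>2 / (2 * Gam \<gamma>s t) \<and>
         (\<gamma> = 1 / (2 * \<alpha>\<phi>) \<longrightarrow>
           (norm (y0 - ystar))\<^sup>2 / (2 * Gam \<gamma>s t)
             = 2 * \<alpha>\<phi> * (norm (y0 - ystar))\<^sup>2 / (real t * (real t + 3))))"
  proof (intro allI impI)
  fix t :: nat assume t: "2 \<le> t"
  define c where "c = (\<lambda>t. \<gamma> * (real t + 1))"
  interpret coupled_problem Pr \<nu>
    using assms by unfold_locales (auto simp: con_row_def split: sum.split)
  have L: "\<alpha>\<phi> * (c t)\<^sup>2 \<le> Gam c t" if "t \<ge> 1" for t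
  proof -
    have "2 * (\<alpha>\<phi> * \<gamma>) \<le> 1"
      using \<open>\<alpha>\<phi> > 0\<close> \<open>\<gamma> \<le> 1 / (2 * \<alpha>\<phi>)\<close> by (simp add: field_simps)
    then have "2 * (\<alpha>\<phi> * \<gamma>) * (\<gamma> * (real t + 1)\<^sup>2) \<le> 1 * (\<gamma> * (real t + 1)\<^sup>2)"
      using \<open>0 < \<gamma>\<close> by (intro mult_right_mono) auto
    \<comment> \<open>The difference of the two polynomials is t - 1, so t = 1 is the tight
      case.\<close>
    moreover have "\<gamma> * (real t + 1)\<^sup>2 \<le> \<gamma> * (real t * (real t + 3))"
      using \<open>0 < \<gamma>\<close> that by (intro mult_left_mono) (auto simp: power2_eq_square algebra_simps)
    ultimately show ?thesis
      unfolding c_def Gam_linear by (simp add: power2_eq_square algebra_simps)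
  qed
  have ystar_aux: "ystar \<in> aux_space Pr" and ystar_min: "\<And>y. y \<in> aux_space Pr \<Longrightarrow> phi Pr ystar \<le> phi Pr y"
    using ystar by (auto simp: is_arg_min_linorder)
  have "xstar \<in> P_feasible Pr"
    using xstar by (simp add: P_optimal_def is_arg_min_def)
  then obtain y where "y \<in> aux_space Pr" "phi Pr y \<le> (\<Sum>i\<in>UNIV. cost Pr i (xstar i))"
    using phi_le_cost[OF connected] by blast
  \<comment> \<open>Allows the value at \<open>ystar\<close> in the bound for \<open>phi\<close> to
    be replaced by the optimal cost of (P).\<close>
  then have opt: "phi Pr ystar \<le> (\<Sum>i\<in>UNIV. cost Pr i (xstar i))"
    using ystar_min by fastforce
  have bound: "(\<Sum>i\<in>UNIV. cost Pr i (local_sol Pr i (yhat Pr c z0 y0 t)) - cost Pr i (xstar i))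
      \<le> (norm (y0 - ystar))\<^sup>2 / (2 * Gam c t)" if "z0 = y0"
  proof -
    obtain n where n: "t = Suc n"
      using t by (cases t) auto
    obtain y z yh where avg: "dual_avg Pr c y0 y0 t = (y, z, yh)"
      by (metis prod_cases3)
    have "Gam c t * (phi Pr yh - phi Pr ystar) + (norm (ystar - z))\<^sup>2 / 2 \<le> (norm (ystar - y0))\<^sup>2 / 2"
      using dual_avg_bound[OF lipschitz_phi _ L \<open>y0 \<in> aux_space Pr\<close> ystar_aux] avg \<open>0 < \<gamma>\<close>
      by (simp add: n c_def)
    then have "Gam c t * (phi Pr yh - phi Pr ystar) \<le> (norm (y0 - ystar))\<^sup>2 / 2"
      using zero_le_power2[of "norm (ystar - z)"] unfolding norm_minus_commute[of ystar y0] by linarith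
    moreover have "Gam c t > 0"
      using t \<open>0 < \<gamma>\<close> by (simp add: c_def Gam_linear)
    ultimately have "phi Pr yh - phi Pr ystar \<le> (norm (y0 - ystar))\<^sup>2 / (2 * Gam c t)"
      by (simp add: field_simps)
    then show ?thesis
      using opt avg that by (simp add: phi_def phi_local_def yhat_def sum_subtractf)
  qed
  have rate: "(norm (y0 - ystar))\<^sup>2 / (2 * Gam c t)
      = 2 * \<alpha>\<phi> * (norm (y0 - ystar))\<^sup>2 / (real t * (real t + 3))" if "\<gamma> = 1 / (2 * \<alpha>\<phi>)"
    unfolding c_def Gam_linear that by simp
  show "let \<gamma>s = (\<lambda>t. \<gamma> * (real t + 1));
        x = (\<lambda>i. local_sol Pr i (yhat Pr \<gamma>s z0 y0 t))
    in x \<in> P_feasible Pr \<and>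
       (z0 = y0 \<longrightarrow>
         (\<Sum>i\<in>UNIV. cost Pr i (x i) - cost Pr i (xstar i))
           \<le> (norm (y0 - ystar))\<^sup>2 / (2 * Gam \<gamma>s t) \<and>
         (\<gamma> = 1 / (2 * \<alpha>\<phi>) \<longrightarrow>
           (norm (y0 - ystar))\<^sup>2 / (2 * Gam \<gamma>s t)
             = 2 * \<alpha>\<phi> * (norm (y0 - ystar))\<^sup>2 / (real t * (real t + 3))))"
    using local_sol_P_feasible bound rate unfolding Let_def c_def by blast
qed

end
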